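(* Let $\mathbf{A}=\mathbf{A}^{\forall}+\mathbf{A}^{\exists}\in\mathbb{IR}^{n\times n}$ be a quantified interval matrix, and define the real matrix $\tilde{A}\in\mathbb{R}^{n\times n}$ by $$\tilde{a}_{ij}=\begin{cases}\operatorname{mig}(\mathbf{a}^{\forall}_{ij})+\operatorname{mag}(\mathbf{a}^{\exists}_{ij}) & \text{if } i=j,\\ -\operatorname{mag}(\mathbf{a}^{\forall}_{ij})-\operatorname{mig}(\mathbf{a}^{\exists}_{ij}) & \text{if } i\neq j.\end{cases}$$ Then $\mathbf{A}$ is an AE H-matrix if and only if $\tilde{A}$ is an M-matrix.
   Context: An interval matrix is a set $\mathbf{A}=\{A\in\mathbb{R}^{m\times n} : \underline{A}\le A\le\overline{A}\}$, where $\underline{A}\le\overline{A}$ are given real matrices and inequalities are entrywise; $\mathbb{IR}^{m\times n}$ is the set of all $m\times n$ interval matrices; its $(i,j)$ entry is the interval $\mathbf{a}_{ij}=[\underline{a}_{ij},\overline{a}_{ij}]$. In a quantified interval matrix each interval entry is associated with either the universal or the existential quantifier, and $\mathbf{A}$ is split disjointly as $\mathbf{A}=\mathbf{A}^{\forall}+\mathbf{A}^{\exists}$: for each position $(i,j)$, the entry $\mathbf{a}_{ij}$ is put into $\mathbf{A}^{\forall}$ if it is universally quantified and into $\mathbf{A}^{\exists}$ if it is existentially quantified, the corresponding entry of the other matrix being $0$. Entries of $\mathbf{A}^{\forall}$, $\mathbf{A}^{\exists}$ are denoted $\mathbf{a}^{\forall}_{ij}$, $\mathbf{a}^{\exists}_{ij}$.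 For a compact real interval $\mathbf{a}$: $\operatorname{mag}(\mathbf{a})=\max\{|a| : a\in\mathbf{a}\}$ and $\operatorname{mig}(\mathbf{a})=\min\{|a| : a\in\mathbf{a}\}$. A real matrix $A\in\mathbb{R}^{n\times n}$ is an M-matrix if its off-diagonal entries are nonpositive and there is $x\in\mathbb{R}^n$ with $x>0$ and $Ax>0$ (entrywise). A real matrix $A\in\mathbb{R}^{n\times n}$ is an H-matrix if its comparison matrix $\langle A\rangle$, defined by $\langle A\rangle_{ii}=|a_{ii}|$ and $\langle A\rangle_{ij}=-|a_{ij}|$ for $i\neq j$, is an M-matrix. $\mathbf{A}$ is an AE H-matrix if for every $A^{\forall}\in\mathbf{A}^{\forall}$ there is $A^{\exists}\in\mathbf{A}^{\exists}$ such that $A^{\forall}+A^{\exists}$ is an H-matrix. *)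

theory Defs
  imports "HOL-Analysis.Analysis" "HOL-Library.Interval"
begin

text \<open>An interval matrix is represented by its matrix of closed real intervals; the type
  \<^typ>\<open>real interval\<close> guarantees lower bound \<open>\<le>\<close> upper bound in every entry. The order on
  \<^typ>\<open>real^'n^'m\<close> is entrywise, so \<open>matrices_of \<AA>\<close> is the set of all real matrices
  lying entrywise between the two bound matrices.\<close>

type_synonym ('m, 'n) interval_matrix = "real interval^'n^'m"

definition matrices_of :: "('m::finite, 'n::finite) interval_matrix \<Rightarrow> (real^'n^'m) set" where
  "matrices_of \<AA> = {map_matrix lower \<AA> .. map_matrix upper \<AA>}"

datatype quantifier = Univ | Exis

text \<open>The zero of \<^typ>\<open>real interval\<close> is the degenerate interval \<open>[0, 0]\<close>.\<close>

definition forall_part ::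
    "quantifier^'n^'m \<Rightarrow> ('m::finite, 'n::finite) interval_matrix \<Rightarrow> ('m, 'n) interval_matrix" where
  "forall_part Q \<AA> = (\<chi> i j. if Q $ i $ j = Univ then \<AA> $ i $ j else 0)"

definition exists_part ::
    "quantifier^'n^'m \<Rightarrow> ('m::finite, 'n::finite) interval_matrix \<Rightarrow> ('m, 'n) interval_matrix" where
  "exists_part Q \<AA> = (\<chi> i j. if Q $ i $ j = Exis then \<AA> $ i $ j else 0)"

lemma forall_part_plus_exists_part: "forall_part Q \<AA> + exists_part Q \<AA> = \<AA>"
proof -
  have "(forall_part Q \<AA> + exists_part Q \<AA>) $ i $ j = \<AA> $ i $ j" for i j
    by (cases "Q $ i $ j") (simp_all add: forall_part_def exists_part_def interval_eq_iff)
  then show ?thesis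
    by (simp add: vec_eq_iff)
qed

text \<open>\<open>Max\<close> and \<open>Min\<close> are only meaningful on finite sets, hence the use of
  \<open>GREATEST\<close> and \<open>LEAST\<close>; the extrema are attained because intervals are compact and nonempty.\<close>

definition mag :: "real interval \<Rightarrow> real" where
  "mag a = (GREATEST r. r \<in> abs ` set_of a)"

definition mig :: "real interval \<Rightarrow> real" where
  "mig a = (LEAST r. r \<in> abs ` set_of a)"

lemma compact_abs_set_of: "compact (abs ` set_of (a :: real interval))"
  by (intro compact_continuous_image continuous_intros) (simp add: set_of_eq)

lemma abs_set_of_nonempty: "abs ` set_of (a :: real interval) \<noteq> {}"
  by (simp add: set_of_eq)

lemma mag_attained: "\<exists>x \<in> set_of a. \<bar>x\<bar> = mag a"
  and abs_le_mag: "x \<in> set_of a \<Longrightarrow> \<bar>x\<bar> \<le> mag a"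
proof -
  obtain s where s: "s \<in> abs ` set_of a" "\<And>t. t \<in> abs ` set_of a \<Longrightarrow> t \<le> s"
    using compact_attains_sup[OF compact_abs_set_of abs_set_of_nonempty, of a] by blast
  then have eq: "mag a = s"
    unfolding mag_def by (intro Greatest_equality)
  show "\<exists>x \<in> set_of a. \<bar>x\<bar> = mag a"
    using s(1) eq by auto
  show "x \<in> set_of a \<Longrightarrow> \<bar>x\<bar> \<le> mag a"
    using s(2) eq by auto
qed

lemma mig_attained: "\<exists>x \<in> set_of a. \<bar>x\<bar> = mig a"
  and mig_le_abs: "x \<in> set_of a \<Longrightarrow> mig a \<le> \<bar>x\<bar>"
proof -
  obtain s where s: "s \<in> abs ` set_of a" "\<And>t. t \<in> abs ` set_of a \<Longrightarrow> s \<le> t"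
    using compact_attains_inf[OF compact_abs_set_of abs_set_of_nonempty, of a] by blast
  then have eq: "mig a = s"
    unfolding mig_def by (intro Least_equality)
  show "\<exists>x \<in> set_of a. \<bar>x\<bar> = mig a"
    using s(1) eq by auto
  show "x \<in> set_of a \<Longrightarrow> mig a \<le> \<bar>x\<bar>"
    using s(2) eq by auto
qed

text \<open>Strict vector inequalities are spelled out by components, because \<open><\<close> on vectors
  is the strict part of \<open>\<le>\<close>, which is not the entrywise strict order.\<close>

definition M_matrix :: "real^'n^'n::finite \<Rightarrow> bool" where
  "M_matrix A \<longleftrightarrow>
     (\<forall>i j. i \<noteq> j \<longrightarrow> A $ i $ j \<le> 0) \<and>
     (\<exists>x. (\<forall>i. 0 < x $ i) \<and> (\<forall>i. 0 < (A *v x) $ i))"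

definition comparison_matrix :: "real^'n^'n::finite \<Rightarrow> real^'n^'n" where
  "comparison_matrix A = (\<chi> i j. if i = j then \<bar>A $ i $ j\<bar> else - \<bar>A $ i $ j\<bar>)"

definition H_matrix :: "real^'n^'n::finite \<Rightarrow> bool" where
  "H_matrix A \<longleftrightarrow> M_matrix (comparison_matrix A)"

definition AE_H_matrix ::
    "quantifier^'n^'n \<Rightarrow> ('n::finite, 'n) interval_matrix \<Rightarrow> bool" where
  "AE_H_matrix Q \<AA> \<longleftrightarrow>
     (\<forall>A1 \<in> matrices_of (forall_part Q \<AA>).
      \<exists>A2 \<in> matrices_of (exists_part Q \<AA>). H_matrix (A1 + A2))"

definition tilde_matrix ::
    "quantifier^'n^'n \<Rightarrow> ('n::finite, 'n) interval_matrix \<Rightarrow> real^'n^'n" where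
  "tilde_matrix Q \<AA> = (\<chi> i j.
     if i = j
     then mig (forall_part Q \<AA> $ i $ j) + mag (exists_part Q \<AA> $ i $ j)
     else - mag (forall_part Q \<AA> $ i $ j) - mig (exists_part Q \<AA> $ i $ j))"

end

theory Submission
  imports Defs
begin

text \<open>In every position one of the two parts is zero, so absolute values add up:
  \<open>\<bar>a + b\<bar> = \<bar>a\<bar> + \<bar>b\<bar>\<close> entrywise, for every choice of matrices from the two parts. The comparison
  matrix of a sum is thus controlled entrywise by magnitudes and mignitudes. The universal
  choice with mignitude on the diagonal and magnitude off it is the worst one, the existential
  choice with magnitude on the diagonal and mignitude off it is the best one, and the property
  of being an M-matrix is inherited by entrywise larger matrices with nonpositive off-diagonal
  entries.\<close>

lemma mem_matrices_of_iff:
  "A \<in> matrices_of \<AA> \<longleftrightarrow> (\<forall>i j. A $ i $ j \<in> set_of (\<AA> $ i $ j))"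
  by (auto simp: matrices_of_def set_of_eq less_eq_vec_def map_matrix_def)

text \<open>Entries of an interval matrix vary independently, so admissible values picked position
  by position assemble into a single member.\<close>

lemma matrices_of_choice:
  assumes "\<And>i j. \<exists>x \<in> set_of (\<AA> $ i $ j). P i j x"
  obtains A where "A \<in> matrices_of \<AA>" "\<And>i j. P i j (A $ i $ j)"
proof -
  from assms obtain f where f: "\<And>i j. f i j \<in> set_of (\<AA> $ i $ j)" "\<And>i j. P i j (f i j)"
    by metis
  show thesis
    by (rule that[of "\<chi> i j. f i j"]) (simp_all add: f mem_matrices_of_iff)
qed

lemma mig_nonneg: "0 \<le> mig a"
  using mig_attained[of a] by auto

lemma mag_nonneg: "0 \<le> mag a"
  using mag_attained[of a] by auto

lemma abs_add_parts:
  assumes "A \<in> matrices_of (forall_part Q \<AA>)" "B \<in> matrices_of (exists_part Q \<AA>)"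
  shows "\<bar>A $ i $ j + B $ i $ j\<bar> = \<bar>A $ i $ j\<bar> + \<bar>B $ i $ j\<bar>"
proof -
  have "A $ i $ j \<in> set_of (forall_part Q \<AA> $ i $ j)" "B $ i $ j \<in> set_of (exists_part Q \<AA> $ i $ j)"
    using assms by (simp_all add: mem_matrices_of_iff)
  then have "A $ i $ j = 0 \<or> B $ i $ j = 0"
    by (cases "Q $ i $ j") (simp_all add: forall_part_def exists_part_def set_of_eq)
  then show ?thesis
    by auto
qed

text \<open>The positive vector \<open>x\<close> that certifies \<open>A\<close> also certifies
  \<open>B\<close>: as \<open>x\<close> is positive, \<open>A \<le> B\<close> gives
  \<open>A *v x \<le> B *v x\<close>.\<close>

lemma M_matrix_mono:
  fixes A B :: "real^'n^'n::finite"
  assumes "M_matrix A" "A \<le> B" "\<And>i j. i \<noteq> j \<Longrightarrow> B $ i $ j \<le> 0"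
  shows "M_matrix B"
proof -
  obtain x where x: "\<And>i. 0 < x $ i" "\<And>i. 0 < (A *v x) $ i"
    using assms(1) unfolding M_matrix_def by blast
  have "0 < (B *v x) $ i" for i
  proof -
    have "(A *v x) $ i \<le> (B *v x) $ i"
      using assms(2) x(1)[THEN less_imp_le]
      by (auto simp: matrix_vector_mult_def less_eq_vec_def intro!: sum_mono mult_right_mono)
    with x(2)[of i] show ?thesis
      by simp
  qed
  with x(1) assms(3) show ?thesis
    unfolding M_matrix_def by blast
qed

theorem theorem8:
  fixes \<AA> :: "('n::finite, 'n) interval_matrix"
    and Q :: "quantifier^'n^'n"
  shows "AE_H_matrix Q \<AA> \<longleftrightarrow> M_matrix (tilde_matrix Q \<AA>)"
proof
  let ?F = "forall_part Q \<AA>" and ?E = "exists_part Q \<AA>"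
  assume AE: "AE_H_matrix Q \<AA>"
  obtain A where A: "A \<in> matrices_of ?F"
    and abs_A: "\<And>i j. \<bar>A $ i $ j\<bar> = (if i = j then mig (?F $ i $ j) else mag (?F $ i $ j))"
    by (rule matrices_of_choice[of ?F "\<lambda>i j x. \<bar>x\<bar> = (if i = j then mig (?F $ i $ j) else mag (?F $ i $ j))"])
      (use mig_attained mag_attained in auto)
  obtain B where B: "B \<in> matrices_of ?E" and M: "M_matrix (comparison_matrix (A + B))"
    using AE A unfolding AE_H_matrix_def H_matrix_def by blast
  have "B $ i $ j \<in> set_of (?E $ i $ j)" for i j
    using B by (simp add: mem_matrices_of_iff)
  \<comment> \<open>With \<open>\<bar>A $ i $ j\<bar>\<close> fixed at its worst value, only
    \<open>B\<close> is unknown: its absolute value is at most \<open>mag\<close> on the diagonal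
    and at least \<open>mig\<close> off it.\<close>
  then have "comparison_matrix (A + B) \<le> tilde_matrix Q \<AA>"
    by (auto simp: less_eq_vec_def comparison_matrix_def tilde_matrix_def abs_add_parts[OF A B] abs_A
        intro: abs_le_mag mig_le_abs)
  then show "M_matrix (tilde_matrix Q \<AA>)"
  proof (rule M_matrix_mono[OF M])
    show "tilde_matrix Q \<AA> $ i $ j \<le> 0" if "i \<noteq> j" for i j
      using that mag_nonneg[of "?F $ i $ j"] mig_nonneg[of "?E $ i $ j"] by (simp add: tilde_matrix_def)
  qed
next
  let ?F = "forall_part Q \<AA>" and ?E = "exists_part Q \<AA>"
  assume M: "M_matrix (tilde_matrix Q \<AA>)"
  \<comment> \<open>This \<open>B\<close> is chosen before any universal matrix, so one existential
    choice serves all of them.\<close>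
  obtain B where B: "B \<in> matrices_of ?E"
    and abs_B: "\<And>i j. \<bar>B $ i $ j\<bar> = (if i = j then mag (?E $ i $ j) else mig (?E $ i $ j))"
    by (rule matrices_of_choice[of ?E "\<lambda>i j x. \<bar>x\<bar> = (if i = j then mag (?E $ i $ j) else mig (?E $ i $ j))"])
      (use mig_attained mag_attained in auto)
  have "H_matrix (A + B)" if A: "A \<in> matrices_of ?F" for A
    unfolding H_matrix_def
  proof (rule M_matrix_mono[OF M])
    have "A $ i $ j \<in> set_of (?F $ i $ j)" for i j
      using A by (simp add: mem_matrices_of_iff)
    \<comment> \<open>Here \<open>B\<close> attains its extremes and \<open>A\<close> is arbitrary,
      so the bounds on \<open>\<bar>A $ i $ j\<bar>\<close> give the reverse inequality.\<close>
    then show "tilde_matrix Q \<AA> \<le> comparison_matrix (A + B)"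
      by (auto simp: less_eq_vec_def comparison_matrix_def tilde_matrix_def abs_add_parts[OF A B] abs_B
          intro: abs_le_mag mig_le_abs)
  qed (simp add: comparison_matrix_def)
  with B show "AE_H_matrix Q \<AA>"
    unfolding AE_H_matrix_def by blast
qed

end
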